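(* For a polynomial $p$ in the class $\mathcal P$, let $S=S_p:E_S\to E_S$ be the dynamical system induced by the secant map of $p$. The following statements hold. (a) For every $p\in\mathcal P$, $S_p:E_S\to E_S$ has no periodic orbits of minimal period either two or three. (b) There exists a polynomial $p^\star\in\mathcal P$ such that $S_{p^\star}$ exhibits an attracting periodic orbit of minimal period four. In particular, there is a nonempty open set of initial conditions in $\mathbb R^2$ for which the iterates of $S_{p^\star}$ do not converge to any root of $p^\star$ (that is, to any point $(\alpha,\alpha)$ with $p^\star(\alpha)=0$).
   Context: $\mathcal P$ is the class of real monic polynomials $p$ of degree $k\ge2$ having exactly $n$ real roots with $1\le n\le k$, all of them simple. Write $p(x)=\sum_{j=0}^k a_jx^j$ with $a_k=1$, and let $q(x,y)=\sum_{j=1}^k a_j\,(x^{j-1}+x^{j-2}y+\dots+xy^{j-2}+y^{j-1})$, the polynomial with $p(x)-p(y)=(x-y)q(x,y)$. Set $\delta_S=\{(x,y)\in\mathbb R^2: x\ne y,\ p(x)=p(y)\}\cup\{(x,x)\in\mathbb R^2: p'(x)=0\}$, which equals $\{q=0\}$. The secant map is $$S_p(x,y)=\left(y,\ y-p(y)\frac{y-x}{p(y)-p(x)}\right),$$ understood on $\mathbb R^2\setminus\delta_S$ (including diagonal points) as $S_p(x,y)=\left(y,\ y-\frac{p(y)}{q(x,y)}\right)$. Set $E_S=\mathbb R^2\setminus\bigcup_{m\ge0}S^{-m}(\delta_S)$, the set of points for which all iterates of $S$ are defined. A point $P\in E_S$ is periodic of minimal period $r\ge 2$ if $S^r(P)=P$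 and $S^\ell(P)\neq P$ for $1\le\ell<r$. The periodic orbit of $P$ is attracting if $P$ is an attracting fixed point of $S^r$: there is $\varepsilon>0$ such that $S^{rm}(y)\to P$ as $m\to\infty$ for all $y\in E_S$ with $|y-P|<\varepsilon$. *)

theory Defs
  imports "HOL-Analysis.Analysis" "HOL-Computational_Algebra.Polynomial"
begin

text \<open>
  Only the real roots are required to be simple; non-real roots are unrestricted.
\<close>

definition class_P :: "real poly set" where
  "class_P = {p. lead_coeff p = 1 \<and> degree p \<ge> 2 \<and>
     (\<exists>n. n = card {x. poly p x = 0} \<and> 1 \<le> n \<and> n \<le> degree p) \<and>
     (\<forall>x. poly p x = 0 \<longrightarrow> order x p = 1)}"

definition secant_q :: "real poly \<Rightarrow> real \<Rightarrow> real \<Rightarrow> real" where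
  "secant_q p x y = (\<Sum>j=1..degree p. coeff p j * (\<Sum>i<j. x ^ (j - 1 - i) * y ^ i))"

definition delta_S :: "real poly \<Rightarrow> (real \<times> real) set" where
  "delta_S p = {(x, y). x \<noteq> y \<and> poly p x = poly p y} \<union> {(x, x) |x. poly (pderiv p) x = 0}"

text \<open>
  The secant map is a partial map with domain the complement of \<open>delta_S p\<close>. Here it is a
  total function whose values on \<open>delta_S p\<close> (where the denominator vanishes) are junk.
\<close>

definition secant_map :: "real poly \<Rightarrow> real \<times> real \<Rightarrow> real \<times> real" where
  "secant_map p = (\<lambda>(x, y). (y, y - poly p y / secant_q p x y))"

text \<open>
  The junk values do not affect the next set: an orbit that meets \<open>delta_S p\<close> is excluded at
  its first visit, and up to that visit only genuine values of the map are used.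
\<close>

definition E_S :: "real poly \<Rightarrow> (real \<times> real) set" where
  "E_S p = UNIV - (\<Union>m. (secant_map p ^^ m) -` delta_S p)"

definition periodic_point :: "real poly \<Rightarrow> nat \<Rightarrow> real \<times> real \<Rightarrow> bool" where
  "periodic_point p r P \<longleftrightarrow> P \<in> E_S p \<and> 2 \<le> r \<and> (secant_map p ^^ r) P = P \<and>
     (\<forall>l. 1 \<le> l \<and> l < r \<longrightarrow> (secant_map p ^^ l) P \<noteq> P)"

definition attracting_periodic_point :: "real poly \<Rightarrow> nat \<Rightarrow> real \<times> real \<Rightarrow> bool" where
  "attracting_periodic_point p r P \<longleftrightarrow> periodic_point p r P \<and>
     (\<exists>\<epsilon>>0. \<forall>z \<in> E_S p. norm (z - P) < \<epsilon> \<longrightarrow>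
        (\<lambda>m. (secant_map p ^^ (r * m)) z) \<longlonglongrightarrow> P)"

lemma secant_q_diff: "poly p x - poly p y = (x - y) * secant_q p x y"
proof -
  have pw: "(x - y) * (\<Sum>i<j. x ^ (j - 1 - i) * y ^ i) = x ^ j - y ^ j" for j
    using power_diff_sumr2[of y j x] by (simp add: algebra_simps)
  have "poly p x - poly p y = (\<Sum>j\<le>degree p. coeff p j * (x ^ j - y ^ j))"
    by (simp add: poly_altdef sum_subtractf right_diff_distrib)
  also have "\<dots> = (\<Sum>j=1..degree p. coeff p j * (x ^ j - y ^ j))"
    by (rule sum.mono_neutral_right) (auto simp: not_less_eq_eq)
  also have "\<dots> = (x - y) * secant_q p x y"
    unfolding secant_q_def sum_distrib_left pw[symmetric]
    by (simp add: sum_distrib_left mult_ac)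
  finally show ?thesis .
qed

lemma secant_q_diag: "secant_q p x x = poly (pderiv p) x"
proof -
  have "(\<Sum>i<j. x ^ (j - 1 - i) * x ^ i) = of_nat j * x ^ (j - 1)" for j
    by (simp flip: power_add)
  hence "secant_q p x x = (\<Sum>j=1..degree p. coeff p j * (of_nat j * x ^ (j - 1)))"
    by (simp add: secant_q_def)
  also have "\<dots> = (\<Sum>j\<le>degree p. coeff p j * (of_nat j * x ^ (j - 1)))"
    by (rule sum.mono_neutral_left) (auto simp: not_less_eq_eq)
  also have "\<dots> = poly (pderiv p) x"
  proof (rule DERIV_unique)
    show "(poly p has_real_derivative poly (pderiv p) x) (at x)"
      by (rule poly_DERIV)
    show "(poly p has_real_derivative (\<Sum>j\<le>degree p. coeff p j * (of_nat j * x ^ (j - 1)))) (at x)"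
      unfolding poly_altdef
      by (auto intro!: derivative_eq_intros sum.cong)
  qed
  finally show ?thesis .
qed

lemma delta_S_iff: "(x, y) \<in> delta_S p \<longleftrightarrow> secant_q p x y = 0"
  using secant_q_diff[of p x y] by (cases "x = y") (auto simp: delta_S_def secant_q_diag)

lemma secant_map_offdiag:
  assumes "x \<noteq> y"
  shows "secant_map p (x, y) = (y, y - poly p y * ((y - x) / (poly p y - poly p x)))"
proof -
  have "poly p y - poly p x = (y - x) * secant_q p x y"
    using secant_q_diff[of p x y] by (simp add: algebra_simps)
  thus ?thesis using assms by (simp add: secant_map_def)
qed

lemma secant_map_E_S: "z \<in> E_S p \<Longrightarrow> secant_map p z \<in> E_S p"
proof -
  assume z: "z \<in> E_S p"
  have "(secant_map p ^^ m) (secant_map p z) \<notin> delta_S p" for m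
    using z funpow_swap1[of "secant_map p" m z] 
    by (auto simp: E_S_def dest: spec[of _ "Suc m"])
  thus ?thesis by (auto simp: E_S_def)
qed

end

theory Submission
  imports Defs
begin

text \<open>
  A step \<open>(x, y) \<mapsto> (y, z)\<close> of the secant map satisfies
  \<open>p(x) (z - y) = p(y) (z - x)\<close>. Summing these relations around a cycle of length three (with
  signs) shows that both sides of each of them vanish, which collapses the cycle.

  For length four, we look for a cycle \<open>(a, b), (b, -a), (-a, -b), (-b, a)\<close> of an even quartic
  \<open>x\<^sup>4 + B x\<^sup>2 + C\<close>. Its existence forces \<open>a/b\<close> to be a root of \<open>t\<^sup>2 + 4 t = 1\<close>, and it determines
  \<open>C\<close> in terms of \<open>B\<close>. The remaining parameter \<open>B\<close> is chosen such that the differential of the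
  secant map at \<open>(b, -a)\<close> has rank one; then the differential of the fourth iterate has rank one
  and is a contraction.
\<close>

section \<open>Cycles of length two and three\<close>

lemma not_delta_S_if_E_S: "P \<in> E_S p \<Longrightarrow> (secant_map p ^^ m) P \<notin> delta_S p"
  by (auto simp: E_S_def)

text \<open>Clearing the denominator gives the first relation. Multiplying
  \<open>secant_q_diff\<close> by \<open>z - y\<close> and inserting the first relation eliminates
  \<open>secant_q\<close> and gives the second, which can be combined around a cycle.\<close>

lemma secant_map_step:
  assumes "(x, y) \<notin> delta_S p" "secant_map p (x, y) = (y, z)"
  shows "(z - y) * secant_q p x y = - poly p y"
    and "poly p x * (z - y) = poly p y * (z - x)"
proof -
  show *: "(z - y) * secant_q p x y = - poly p y"
    using assms by (auto simp: delta_S_iff secant_map_def field_simps)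
  have "poly p x - poly p y = (x - y) * secant_q p x y"
    by (rule secant_q_diff)
  with * show "poly p x * (z - y) = poly p y * (z - x)"
    by algebra
qed

lemma secant_map_fixed_if_root:
  assumes "(x, y) \<notin> delta_S p" "secant_map p (x, y) = (y, z)" "poly p y = 0"
  shows "z = y"
  using secant_map_step(1)[OF assms(1,2)] assms by (simp add: delta_S_iff)

lemma no_periodic_point_2: "\<not> periodic_point p 2 P"
proof
  assume per: "periodic_point p 2 P"
  obtain x y where P: "P = (x, y)" by (cases P)
  have E: "P \<in> E_S p" and ret: "secant_map p (secant_map p (x, y)) = (x, y)"
    using per by (auto simp: periodic_point_def numeral_2_eq_2 P)
  have 1: "secant_map p (x, y) = (y, x)" and 2: "secant_map p (y, x) = (x, y)"
    using ret by (auto simp: secant_map_def)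
  have d1: "(x, y) \<notin> delta_S p" using not_delta_S_if_E_S[OF E, of 0] by (simp add: P)
  have d2: "(y, x) \<notin> delta_S p" using not_delta_S_if_E_S[OF E, of 1] by (simp add: P 1)
  \<comment> \<open>For \<open>z = x\<close> the right side of the step relation vanishes, so
    \<open>x = y\<close> or \<open>poly p x = 0\<close>. In the latter case the step from
    \<open>(y, x)\<close> cannot move, so again \<open>x = y\<close>.\<close>
  have "x = y"
    using secant_map_step(2)[OF d1 1] secant_map_fixed_if_root[OF d2 2] by auto
  hence "secant_map p P = P" using 1 by (simp add: P)
  thus False using per by (auto simp: periodic_point_def dest: spec[of _ 1])
qed

lemma no_periodic_point_3: "\<not> periodic_point p 3 P"
proof
  assume per: "periodic_point p 3 P"
  obtain x y where P: "P = (x, y)" by (cases P)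
  have E: "P \<in> E_S p"
    and ret: "secant_map p (secant_map p (secant_map p (x, y))) = (x, y)"
    using per by (auto simp: periodic_point_def numeral_3_eq_3 P)
  obtain z where 1: "secant_map p (x, y) = (y, z)" by (simp add: secant_map_def)
  obtain w where w: "secant_map p (y, z) = (z, w)" by (simp add: secant_map_def)
  have "secant_map p (z, w) = (x, y)" using ret by (simp add: 1 w)
  moreover from this have "w = x" by (simp add: secant_map_def)
  ultimately have 2: "secant_map p (y, z) = (z, x)" and 3: "secant_map p (z, x) = (x, y)"
    using w by simp_all
  have d1: "(x, y) \<notin> delta_S p" using not_delta_S_if_E_S[OF E, of 0] by (simp add: P)
  have d2: "(y, z) \<notin> delta_S p" using not_delta_S_if_E_S[OF E, of 1] by (simp add: P 1)
  have d3: "(z, x) \<notin> delta_S p"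
    using not_delta_S_if_E_S[OF E, of 2] by (simp add: P 1 2 numeral_2_eq_2)
  note s = secant_map_step(2)[OF d1 1] secant_map_step(2)[OF d2 2] secant_map_step(2)[OF d3 3]
  \<comment> \<open>Call the three products A, B, C. The step relations read A = -B, B = -C, C = -A;
    since the cycle has odd length, A = -A.\<close>
  have "poly p x * (z - y) = 0" "poly p y * (x - z) = 0" "poly p z * (y - x) = 0"
    using s by algebra+
  \<comment> \<open>Each vanishing product identifies two of \<open>x\<close>, \<open>y\<close>,
    \<open>z\<close>, either directly or through a root that stops the next step; no single
    coincidence satisfies all three conditions.\<close>
  with secant_map_fixed_if_root[OF d1 1] secant_map_fixed_if_root[OF d2 2]
    secant_map_fixed_if_root[OF d3 3]
  have "x = y" "z = y" by auto
  hence "secant_map p P = P" using 1 by (simp add: P)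
  thus False using per by (auto simp: periodic_point_def dest: spec[of _ 1])
qed

section \<open>Linearly stable periodic points\<close>

lemma contraction_near_fixed_point:
  fixes f :: "'a::real_normed_vector \<Rightarrow> 'a"
  assumes der: "(f has_derivative L) (at P)" and fP: "f P = P"
    and L: "\<And>v. norm (L v) \<le> k * norm v" and k: "k < 1"
  obtains e c where "e > 0" "0 \<le> c" "c < 1"
    "\<And>z. norm (z - P) < e \<Longrightarrow> norm (f z - P) \<le> c * norm (z - P)"
proof -
  \<comment> \<open>The midpoint of \<open>k\<close> and 1 leaves the room \<open>d\<close> for the
    remainder of the linear approximation; the maximum secures \<open>0 \<le> c\<close>, as
    \<open>k\<close> has no assumed sign.\<close>
  define c where "c = max 0 ((k + 1) / 2)"
  define d where "d = c - k"
  have d: "d > 0" using k by (auto simp: c_def d_def max_def field_simps)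
  obtain e where e: "e > 0"
    "\<And>z. norm (z - P) < e \<Longrightarrow> norm (f z - f P - L (z - P)) \<le> d * norm (z - P)"
    using der d unfolding has_derivative_at_alt by metis
  have "norm (f z - P) \<le> c * norm (z - P)" if "norm (z - P) < e" for z
  proof -
    have "norm (f z - P) \<le> norm (f z - f P - L (z - P)) + norm (L (z - P))"
      using norm_triangle_ineq[of "f z - f P - L (z - P)" "L (z - P)"] by (simp add: fP)
    also have "\<dots> \<le> d * norm (z - P) + k * norm (z - P)"
      by (intro add_mono e(2) L that)
    also have "\<dots> = c * norm (z - P)" by (simp add: d_def algebra_simps)
    finally show ?thesis .
  qed
  moreover have "0 \<le> c" "c < 1" using k by (auto simp: c_def)
  ultimately show thesis using that e(1) by blast
qed

lemma contraction_iterates: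
  fixes f :: "'a::real_normed_vector \<Rightarrow> 'a"
  assumes c: "0 \<le> c" "c < 1"
    and f: "\<And>z. norm (z - P) < e \<Longrightarrow> norm (f z - P) \<le> c * norm (z - P)"
    and z: "norm (z - P) < e"
  shows "norm ((f ^^ m) z - P) < e" "(\<lambda>m. (f ^^ m) z) \<longlonglongrightarrow> P"
proof -
  \<comment> \<open>The two claims are proved together: the estimate for \<open>f\<close> applies
    again only while the iterate stays in the ball.\<close>
  have *: "norm ((f ^^ m) z - P) \<le> c ^ m * norm (z - P) \<and> norm ((f ^^ m) z - P) < e" for m
  proof (induction m)
    case (Suc m)
    have "norm ((f ^^ Suc m) z - P) \<le> c * norm ((f ^^ m) z - P)"
      using f Suc by simp
    moreover have "\<dots> \<le> c * (c ^ m * norm (z - P))"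
      using Suc c by (intro mult_left_mono) auto
    moreover have "c * norm ((f ^^ m) z - P) \<le> 1 * norm ((f ^^ m) z - P)"
      using c by (intro mult_right_mono) auto
    ultimately show ?case using Suc by (auto simp: mult.assoc)
  qed (use z in auto)
  thus "norm ((f ^^ m) z - P) < e" by blast
  have "(\<lambda>m. c ^ m * norm (z - P)) \<longlonglongrightarrow> 0"
    using c by (auto intro!: tendsto_mult_left_zero LIMSEQ_power_zero)
  hence "(\<lambda>m. (f ^^ m) z - P) \<longlonglongrightarrow> 0"
    by (rule Lim_null_comparison[rotated]) (use * in auto)
  thus "(\<lambda>m. (f ^^ m) z) \<longlonglongrightarrow> P" by (simp add: LIM_zero_iff)
qed

lemma closed_delta_S: "closed (delta_S p)"
proof -
  have "delta_S p = (\<lambda>z. secant_q p (fst z) (snd z)) -` {0}"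
    using delta_S_iff by (auto simp: prod_eq_iff)
  moreover have "continuous_on UNIV (\<lambda>z. secant_q p (fst z) (snd z))"
    unfolding secant_q_def by (intro continuous_intros)
  ultimately show ?thesis by (simp add: continuous_on_eq_continuous_at closed_vimage)
qed

text \<open>Convergence follows from the contraction. Membership in \<open>E_S\<close> is an
  infinite family of conditions; on a ball mapped into itself by the \<open>r\<close>-th iterate it
  reduces to the first \<open>r\<close> of them, and these are open conditions at
  \<open>P\<close>.\<close>

lemma linearly_stable_periodic_point:
  assumes per: "periodic_point p r P"
    and cont: "\<And>j. j < r \<Longrightarrow> isCont (secant_map p ^^ j) P"
    and der: "((secant_map p ^^ r) has_derivative L) (at P)"
    and L: "\<And>v. norm (L v) \<le> k * norm v" and k: "k < 1"
  shows "attracting_periodic_point p r P"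
    and "\<exists>U. open U \<and> P \<in> U \<and> U \<subseteq> E_S p \<and> (\<forall>z\<in>U. (\<lambda>m. (secant_map p ^^ (r * m)) z) \<longlonglongrightarrow> P)"
proof -
  let ?S = "secant_map p"
  have P: "P \<in> E_S p" "(?S ^^ r) P = P" "r \<ge> 2"
    using per by (auto simp: periodic_point_def)
  obtain e c where e: "e > 0" "0 \<le> c" "c < 1"
    "\<And>z. norm (z - P) < e \<Longrightarrow> norm ((?S ^^ r) z - P) \<le> c * norm (z - P)"
    using contraction_near_fixed_point[OF der P(2) L k] by blast
  have lim: "(\<lambda>m. (?S ^^ (r * m)) z) \<longlonglongrightarrow> P" if "norm (z - P) < e" for z
    using contraction_iterates(2)[OF e(2-4) that] by (simp add: funpow_mult)
  thus "attracting_periodic_point p r P"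
    using per e(1) by (auto simp: attracting_periodic_point_def)
  have "eventually (\<lambda>z. (?S ^^ j) z \<in> - delta_S p) (nhds P)" if "j < r" for j
  proof (rule topological_tendstoD)
    show "((?S ^^ j) \<longlongrightarrow> (?S ^^ j) P) (nhds P)"
      using cont[OF that] by (simp add: isCont_def tendsto_nhds_iff)
    show "open (- delta_S p)" using closed_delta_S by (simp add: open_Compl)
    show "(?S ^^ j) P \<in> - delta_S p" using not_delta_S_if_E_S[OF P(1)] by simp
  qed
  hence "eventually (\<lambda>z. \<forall>j\<in>{..<r}. (?S ^^ j) z \<in> - delta_S p) (nhds P)"
    by (intro eventually_ball_finite) auto
  then obtain d where d: "d > 0"
    "\<And>z j. dist z P < d \<Longrightarrow> j < r \<Longrightarrow> (?S ^^ j) z \<notin> delta_S p"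
    by (auto simp: eventually_nhds_metric)
  define U where "U = ball P (min d e)"
  have "z \<in> E_S p" if "z \<in> U" for z
  proof -
    have z: "norm (z - P) < min d e" using that by (simp add: U_def dist_norm norm_minus_commute)
    have "(?S ^^ m) z \<notin> delta_S p" for m
    proof -
      \<comment> \<open>Complete rounds keep the point in the ball, and the remaining
        \<open>m mod r\<close> steps are covered by the choice of \<open>d\<close>.\<close>
      have "norm (((?S ^^ r) ^^ (m div r)) z - P) < min d e"
        by (rule contraction_iterates(1)[OF e(2,3) _ z]) (use e(4) in auto)
      hence "(?S ^^ (m mod r)) ((?S ^^ (r * (m div r))) z) \<notin> delta_S p"
        using P(3) by (intro d(2)) (auto simp: funpow_mult dist_norm)
      moreover have "(?S ^^ (m mod r)) ((?S ^^ (r * (m div r))) z) = (?S ^^ m) z"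
        by (metis comp_apply funpow_add mod_mult_div_eq)
      ultimately show ?thesis by simp
    qed
    thus ?thesis by (auto simp: E_S_def)
  qed
  moreover have "open U" "P \<in> U" using d e by (auto simp: U_def)
  moreover have "\<forall>z\<in>U. (\<lambda>m. (?S ^^ (r * m)) z) \<longlonglongrightarrow> P"
    using lim by (auto simp: U_def dist_norm norm_minus_commute)
  ultimately show "\<exists>U. open U \<and> P \<in> U \<and> U \<subseteq> E_S p \<and>
      (\<forall>z\<in>U. (\<lambda>m. (?S ^^ (r * m)) z) \<longlonglongrightarrow> P)" by blast
qed

section \<open>A quartic with an attracting cycle of length four\<close>

definition tau :: real where "tau = sqrt 5 - 2"

lemma tau_square: "tau\<^sup>2 = 1 - 4 * tau"
  by (simp add: tau_def power2_eq_square algebra_simps)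

lemma tau_bounds: "23 / 100 < tau" "tau < 24 / 100"
proof -
  have "223 / 100 < sqrt 5" by (rule real_less_rsqrt) (simp add: power2_eq_square)
  thus "23 / 100 < tau" by (simp add: tau_def)
  have "sqrt 5 < 224 / 100" by (rule real_less_lsqrt) (simp_all add: power2_eq_square)
  thus "tau < 24 / 100" by (simp add: tau_def)
qed

text \<open>The cycle has a = \<open>tau\<close> and b = 1. The coefficient B =
  \<open>6 * tau - 4\<close> solves 3 - 2 tau + tau^2 + B = 0, the vanishing of the partial
  derivative of \<open>secant_q\<close> in x at \<open>(1, - tau)\<close>. The step from
  \<open>(tau, 1)\<close> to \<open>(1, - tau)\<close> then forces the constant term.\<close>

definition cycle_poly :: "real poly" where
  "cycle_poly = [:18 * tau - 5, 0, 6 * tau - 4, 0, 1:]"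

lemma poly_cycle_poly: "poly cycle_poly x = x ^ 4 + (6 * tau - 4) * x\<^sup>2 + (18 * tau - 5)"
  by (simp add: cycle_poly_def algebra_simps power2_eq_square power4_eq_xxxx)

lemma degree_cycle_poly: "degree cycle_poly = 4"
  by (simp add: cycle_poly_def)

lemma secant_q_cycle_poly: "secant_q cycle_poly x y = (x + y) * (x\<^sup>2 + y\<^sup>2 + (6 * tau - 4))"
proof -
  have "{1..4::nat} = {1, 2, 3, 4}" by auto
  thus ?thesis
    unfolding secant_q_def degree_cycle_poly
    by (simp add: cycle_poly_def numeral_eq_Suc algebra_simps)
qed

lemma cycle_poly_in_class_P: "cycle_poly \<in> class_P"
proof -
  have monic: "lead_coeff cycle_poly = 1" by (simp add: cycle_poly_def)
  have nz: "cycle_poly \<noteq> 0" by (simp add: cycle_poly_def)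
  have "poly cycle_poly 0 < 0" using tau_bounds by (simp add: poly_cycle_poly)
  moreover have "poly cycle_poly 2 > 0" using tau_bounds by (simp add: poly_cycle_poly)
  ultimately obtain x where "poly cycle_poly x = 0"
    using poly_IVT_pos[of 0 2 cycle_poly] by auto
  hence "card {x. poly cycle_poly x = 0} \<ge> 1"
    using poly_roots_finite[OF nz] by (auto simp: Suc_le_eq card_gt_0_iff)
  moreover have "card {x. poly cycle_poly x = 0} \<le> degree cycle_poly"
    by (rule card_poly_roots_bound[OF nz])
  moreover have "order x cycle_poly = 1" if x: "poly cycle_poly x = 0" for x
  proof -
    have d: "poly (pderiv cycle_poly) x = 2 * x * (2 * x\<^sup>2 + (6 * tau - 4))"
      by (simp add: cycle_poly_def pderiv_pCons algebra_simps power2_eq_square)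
    \<comment> \<open>All critical values are negative: at 0 by the sign of the constant term, at
      the other critical points by completing the square.\<close>
    have "poly (pderiv cycle_poly) x \<noteq> 0"
    proof
      assume "poly (pderiv cycle_poly) x = 0"
      then consider "x = 0" | "2 * x\<^sup>2 = 4 - 6 * tau" by (auto simp: d)
      thus False
      proof cases
        case 1
        with x tau_bounds show False by (simp add: poly_cycle_poly)
      next
        case 2
        have "4 * poly cycle_poly x =
            (2 * x\<^sup>2 + (6 * tau - 4))\<^sup>2 + 4 * (18 * tau - 5) - (6 * tau - 4)\<^sup>2"
          by (simp add: poly_cycle_poly algebra_simps power2_eq_square power4_eq_xxxx)
        also have "\<dots> = 4 * (18 * tau - 5) - (6 * tau - 4)\<^sup>2" using 2 by simp
        also have "\<dots> = 72 * tau - 20 - (6 * tau - 4)\<^sup>2" by (simp add: algebra_simps)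
        finally have "72 * tau - 20 = (6 * tau - 4)\<^sup>2" using x by simp
        moreover have "(6 * tau - 4)\<^sup>2 \<ge> 0" by simp
        ultimately have "72 * tau - 20 \<ge> 0" by (simp only:)
        thus False using tau_bounds by simp
      qed
    qed
    hence "order x (pderiv cycle_poly) = 0" by (simp add: order_root)
    thus ?thesis using order_pderiv[OF nz x] by simp
  qed
  ultimately show ?thesis
    using monic by (simp add: class_P_def degree_cycle_poly)
qed

section \<open>Steps and differentials of the secant map along the cycle\<close>

text \<open>With the value of the denominator as a parameter \<open>q\<close>, the step becomes a
  polynomial identity in \<open>tau\<close>, to be checked modulo \<open>tau_square\<close>.\<close>

lemma secant_map_cycle_poly_eqI:
  assumes "q = (x + y) * (x\<^sup>2 + y\<^sup>2 + (6 * tau - 4))" "q \<noteq> 0"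
    and "(y - z) * q = poly cycle_poly y"
  shows "secant_map cycle_poly (x, y) = (y, z)"
proof -
  have "secant_map cycle_poly (x, y) = (y, y - poly cycle_poly y / q)"
    by (simp add: secant_map_def secant_q_cycle_poly assms(1))
  thus ?thesis using assms(2) by (simp flip: assms(3))
qed

text \<open>The quotient rule, with the partial derivatives \<open>u\<close> and \<open>v\<close> of
  the second component multiplied by the square of \<open>q\<close>, so that again only polynomial
  identities remain to be checked.\<close>

lemma has_derivative_secant_map_cycle_poly:
  assumes q: "q = (x + y) * (x\<^sup>2 + y\<^sup>2 + (6 * tau - 4))" "q \<noteq> 0"
    and u: "u * q\<^sup>2 = poly cycle_poly y * (3 * x\<^sup>2 + 2 * x * y + y\<^sup>2 + (6 * tau - 4))"
    and v: "(1 - v) * q\<^sup>2 = (4 * y ^ 3 + 2 * (6 * tau - 4) * y) * q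
              - poly cycle_poly y * (x\<^sup>2 + 2 * x * y + 3 * y\<^sup>2 + (6 * tau - 4))"
  shows "(secant_map cycle_poly has_derivative (\<lambda>w. (snd w, u * fst w + v * snd w))) (at (x, y))"
proof -
  let ?B = "6 * tau - 4" and ?C = "18 * tau - 5"
  define num where "num = (\<lambda>z::real\<times>real. snd z ^ 4 + ?B * (snd z)\<^sup>2 + ?C)"
  define den where "den = (\<lambda>z::real\<times>real. (fst z + snd z) * ((fst z)\<^sup>2 + (snd z)\<^sup>2 + ?B))"
  define qx where "qx = 3 * x\<^sup>2 + 2 * x * y + y\<^sup>2 + ?B"
  define qy where "qy = x\<^sup>2 + 2 * x * y + 3 * y\<^sup>2 + ?B"
  define dn where "dn = 4 * y ^ 3 + 2 * ?B * y"
  have S: "secant_map cycle_poly = (\<lambda>z. (snd z, snd z - num z / den z))"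
    by (auto simp: secant_map_def fun_eq_iff secant_q_cycle_poly num_def den_def poly_cycle_poly)
  have n: "(num has_derivative (\<lambda>w. dn * snd w)) (at (x, y))"
    unfolding num_def dn_def
    by (auto intro!: derivative_eq_intros simp: fun_eq_iff algebra_simps)
  have d: "(den has_derivative (\<lambda>w. qx * fst w + qy * snd w)) (at (x, y))"
    unfolding den_def qx_def qy_def
    by (auto intro!: derivative_eq_intros simp: fun_eq_iff algebra_simps power2_eq_square)
  have vals: "num (x, y) = poly cycle_poly y" "den (x, y) = q"
    by (simp_all add: num_def den_def poly_cycle_poly q(1))
  have u': "u = poly cycle_poly y * qx / q\<^sup>2"
    using u q(2) by (simp add: field_simps qx_def)
  have v': "v = 1 - (dn * q - poly cycle_poly y * qy) / q\<^sup>2"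
    using v q(2) by (simp add: field_simps qy_def dn_def)
  have "((\<lambda>z. (snd z, snd z - num z / den z)) has_derivative
      (\<lambda>w. (snd w, snd w - (dn * snd w * den (x, y) - num (x, y) * (qx * fst w + qy * snd w))
         / (den (x, y) * den (x, y))))) (at (x, y))"
    by (intro has_derivative_Pair has_derivative_diff has_derivative_snd has_derivative_ident
        has_derivative_divide' n d) (simp add: vals q(2))
  moreover have "(\<lambda>w. (snd w, snd w - (dn * snd w * den (x, y) - num (x, y) * (qx * fst w + qy * snd w))
         / (den (x, y) * den (x, y)))) = (\<lambda>w. (snd w, u * fst w + v * snd w))"
    using q(2) by (auto simp: fun_eq_iff vals u' v' field_simps power2_eq_square)
  ultimately show ?thesis by (simp add: S)
qed

lemma tau_factor_nonzero: "- 8 * tau \<noteq> 0" "8 * tau \<noteq> 0" "12 * tau - 4 \<noteq> 0" "4 - 12 * tau \<noteq> 0"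
  using tau_bounds by auto

text \<open>These are the values of \<open>secant_q\<close> at the four points in orbit order,
  reduced to linear expressions in \<open>tau\<close>. The last two are the negatives of the first
  two, as \<open>secant_q\<close> is odd here.\<close>

lemma cycle_q:
  "- 8 * tau = (tau + 1) * (tau\<^sup>2 + 1\<^sup>2 + (6 * tau - 4))"
  "12 * tau - 4 = (1 + - tau) * (1\<^sup>2 + (- tau)\<^sup>2 + (6 * tau - 4))"
  "8 * tau = (- tau + - 1) * ((- tau)\<^sup>2 + (- 1)\<^sup>2 + (6 * tau - 4))"
  "4 - 12 * tau = (- 1 + tau) * ((- 1)\<^sup>2 + tau\<^sup>2 + (6 * tau - 4))"
  unfolding power_one power2_minus using tau_square by algebra+

lemma cycle_steps:
  "secant_map cycle_poly (tau, 1) = (1, - tau)"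
  "secant_map cycle_poly (1, - tau) = (- tau, - 1)"
  "secant_map cycle_poly (- tau, - 1) = (- 1, tau)"
  "secant_map cycle_poly (- 1, tau) = (tau, 1)"
proof -
  show "secant_map cycle_poly (tau, 1) = (1, - tau)"
    by (rule secant_map_cycle_poly_eqI[OF cycle_q(1) tau_factor_nonzero(1)])
      (unfold poly_cycle_poly power_one power2_minus mult_1_left mult_1_right, use tau_square in algebra)
  show "secant_map cycle_poly (1, - tau) = (- tau, - 1)"
    by (rule secant_map_cycle_poly_eqI[OF cycle_q(2) tau_factor_nonzero(3)])
      (unfold poly_cycle_poly power_one power2_minus mult_1_left mult_1_right, use tau_square in algebra)
  show "secant_map cycle_poly (- tau, - 1) = (- 1, tau)"
    by (rule secant_map_cycle_poly_eqI[OF cycle_q(3) tau_factor_nonzero(2)])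
      (unfold poly_cycle_poly power_one power2_minus mult_1_left mult_1_right, use tau_square in algebra)
  show "secant_map cycle_poly (- 1, tau) = (tau, 1)"
    by (rule secant_map_cycle_poly_eqI[OF cycle_q(4) tau_factor_nonzero(4)])
      (unfold poly_cycle_poly power_one power2_minus mult_1_left mult_1_right, use tau_square in algebra)
qed

text \<open>Opposite points share a differential, because the secant map of an even polynomial
  commutes with negation. The entry 0 at \<open>(1, - tau)\<close> is the rank drop for which the
  quadratic coefficient was chosen.\<close>

lemma cycle_derivatives:
  defines "D \<equiv> \<lambda>u v w. (snd w, u * fst w + v * snd w :: real)"
  shows
    "(secant_map cycle_poly has_derivative D ((tau + 1) / 2) (- tau)) (at (tau, 1))"
    "(secant_map cycle_poly has_derivative D 0 (3 + tau)) (at (1, - tau))"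
    "(secant_map cycle_poly has_derivative D ((tau + 1) / 2) (- tau)) (at (- tau, - 1))"
    "(secant_map cycle_poly has_derivative D 0 (3 + tau)) (at (- 1, tau))"
proof -
  have half: "2 * ((tau + 1) / 2) = tau + 1" by simp
  show "(secant_map cycle_poly has_derivative D ((tau + 1) / 2) (- tau)) (at (tau, 1))"
    unfolding D_def
    by (rule has_derivative_secant_map_cycle_poly[OF cycle_q(1) tau_factor_nonzero(1)])
      (unfold poly_cycle_poly power_one power2_minus mult_1_left mult_1_right,
        (use tau_square half in algebra), (use tau_square in algebra))
  show "(secant_map cycle_poly has_derivative D 0 (3 + tau)) (at (1, - tau))"
    unfolding D_def
    by (rule has_derivative_secant_map_cycle_poly[OF cycle_q(2) tau_factor_nonzero(3)])
      (unfold poly_cycle_poly power_one power2_minus mult_1_left mult_1_right,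
        (use tau_square in algebra)+)
  show "(secant_map cycle_poly has_derivative D ((tau + 1) / 2) (- tau)) (at (- tau, - 1))"
    unfolding D_def
    by (rule has_derivative_secant_map_cycle_poly[OF cycle_q(3) tau_factor_nonzero(2)])
      (unfold poly_cycle_poly power_one power2_minus mult_1_left mult_1_right,
        (use tau_square half in algebra), (use tau_square in algebra))
  show "(secant_map cycle_poly has_derivative D 0 (3 + tau)) (at (- 1, tau))"
    unfolding D_def
    by (rule has_derivative_secant_map_cycle_poly[OF cycle_q(4) tau_factor_nonzero(4)])
      (unfold poly_cycle_poly power_one power2_minus mult_1_left mult_1_right,
        (use tau_square in algebra)+)
qed

section \<open>Periodicity of the cycle and contraction by the fourth iterate\<close>

lemma cycle_iterates:
  "(secant_map cycle_poly ^^ 1) (tau, 1) = (1, - tau)"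
  "(secant_map cycle_poly ^^ 2) (tau, 1) = (- tau, - 1)"
  "(secant_map cycle_poly ^^ 3) (tau, 1) = (- 1, tau)"
  "(secant_map cycle_poly ^^ 4) (tau, 1) = (tau, 1)"
  by (simp_all add: numeral_eq_Suc cycle_steps)

lemma less_4_cases: "(j::nat) < 4 \<Longrightarrow> j = 0 \<or> j = 1 \<or> j = 2 \<or> j = 3"
  by auto

lemma periodic_point_cycle_poly: "periodic_point cycle_poly 4 (tau, 1)"
proof -
  let ?S = "secant_map cycle_poly"
  have q: "secant_q cycle_poly tau 1 \<noteq> 0" "secant_q cycle_poly 1 (- tau) \<noteq> 0"
    "secant_q cycle_poly (- tau) (- 1) \<noteq> 0" "secant_q cycle_poly (- 1) tau \<noteq> 0"
    unfolding secant_q_cycle_poly cycle_q[symmetric] by (rule tau_factor_nonzero)+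
  have "(?S ^^ m) (tau, 1) \<notin> delta_S cycle_poly" for m
  proof -
    have "((?S ^^ 4) ^^ k) (tau, 1) = (tau, 1)" for k
      by (induction k) (simp_all add: cycle_iterates)
    hence "(?S ^^ m) (tau, 1) = (?S ^^ (m mod 4)) (tau, 1)"
      by (metis comp_apply funpow_add funpow_mult mod_mult_div_eq)
    moreover have "(?S ^^ j) (tau, 1) \<notin> delta_S cycle_poly" if "j < 4" for j
      using less_4_cases[OF that]
      by (elim disjE) (simp_all add: cycle_iterates cycle_steps delta_S_iff q)
    ultimately show ?thesis by simp
  qed
  moreover have "(?S ^^ l) (tau, 1) \<noteq> (tau, 1)" if "1 \<le> l" "l < 4" for l
    using less_4_cases[OF that(2)] that(1) tau_bounds by (auto simp: cycle_iterates cycle_steps)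
  ultimately show ?thesis
    by (auto simp: periodic_point_def E_S_def cycle_iterates)
qed

lemma cycle_poly_stability:
  "attracting_periodic_point cycle_poly 4 (tau, 1)"
  "\<exists>U. open U \<and> (tau, 1) \<in> U \<and> U \<subseteq> E_S cycle_poly \<and>
     (\<forall>z\<in>U. (\<lambda>m. (secant_map cycle_poly ^^ (4 * m)) z) \<longlonglongrightarrow> (tau, 1))"
proof -
  let ?S = "secant_map cycle_poly"
  define D where "D = (\<lambda>u v w. (snd w, u * fst w + v * snd w :: real))"
  define A where "A = D ((tau + 1) / 2) (- tau)"
  define B where "B = D 0 (3 + tau)"
  have ders: "(?S has_derivative A) (at (tau, 1))" "(?S has_derivative B) (at (1, - tau))"
    "(?S has_derivative A) (at (- tau, - 1))" "(?S has_derivative B) (at (- 1, tau))"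
    unfolding A_def B_def D_def by (rule cycle_derivatives)+
  have 1: "((?S ^^ 1) has_derivative A) (at (tau, 1))"
    using ders(1) by simp
  have 2: "((?S ^^ 2) has_derivative B \<circ> A) (at (tau, 1))"
    using diff_chain_at[OF 1, of ?S B] ders(2) cycle_iterates(1) by (simp add: numeral_2_eq_2)
  have 3: "((?S ^^ 3) has_derivative A \<circ> (B \<circ> A)) (at (tau, 1))"
    using diff_chain_at[OF 2, of ?S A] ders(3) cycle_iterates(2)
    by (simp add: eval_nat_numeral o_assoc)
  have 4: "((?S ^^ 4) has_derivative B \<circ> (A \<circ> (B \<circ> A))) (at (tau, 1))"
    using diff_chain_at[OF 3, of ?S B] ders(4) cycle_iterates(3)
    by (simp add: eval_nat_numeral o_assoc)
  have cont: "isCont (?S ^^ j) (tau, 1)" if "j < 4" for j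
    using less_4_cases[OF that] 1 2 3 by (auto dest: has_derivative_continuous)
  \<comment> \<open>The differential \<open>B \<circ> A\<close> of two steps has rank one: it sends
    \<open>w\<close> to \<open>l\<close> times the vector \<open>(1, 3 + tau)\<close>, with
    \<open>l\<close> a linear form in \<open>w\<close>. Here \<open>\<mu>\<close> is the value of
    that form at \<open>(1, 3 + tau)\<close>, so applying \<open>B \<circ> A\<close> once more
    multiplies by \<open>\<mu>\<close>.\<close>
  define \<mu> where "\<mu> = (tau + 1) / 2 - tau * (3 + tau)"
  have "2 * \<mu> = 3 * tau - 1"
    using tau_square by (simp add: \<mu>_def power2_eq_square add_divide_distrib algebra_simps)
  hence \<mu>: "\<bar>\<mu>\<bar> \<le> 16 / 100"
    using tau_bounds by linarith
  have BA: "B (A (h, k)) = ((tau + 1) / 2 * h - tau * k, (3 + tau) * ((tau + 1) / 2 * h - tau * k))"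
    for h k by (simp add: A_def B_def D_def)
  have abs_tau: "\<bar>3 + tau\<bar> = 3 + tau" using tau_bounds by simp
  have \<mu>_mult: "(tau + 1) / 2 * l - tau * ((3 + tau) * l) = \<mu> * l" for l
    by (simp only: \<mu>_def left_diff_distrib mult.assoc)
  have "norm ((B \<circ> (A \<circ> (B \<circ> A))) w) \<le> 6 / 10 * norm w" for w
  proof -
    obtain h k where w: "w = (h, k)" by (cases w)
    define l where "l = (tau + 1) / 2 * h - tau * k"
    have "\<bar>h\<bar> \<le> norm w" "\<bar>k\<bar> \<le> norm w"
      using norm_fst_le[of h k] norm_snd_le[of k h] by (simp_all add: w)
    hence "\<bar>(tau + 1) / 2 * h\<bar> + \<bar>tau * k\<bar> \<le> 62 / 100 * norm w + 24 / 100 * norm w"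
      unfolding abs_mult using tau_bounds by (intro add_mono mult_mono) auto
    hence l: "\<bar>l\<bar> \<le> 86 / 100 * norm w"
      unfolding l_def by linarith
    have "(B \<circ> (A \<circ> (B \<circ> A))) w = (\<mu> * l, (3 + tau) * (\<mu> * l))"
      by (simp only: o_apply w BA \<mu>_mult flip: l_def)
    hence "norm ((B \<circ> (A \<circ> (B \<circ> A))) w) \<le> \<bar>\<mu> * l\<bar> + \<bar>(3 + tau) * (\<mu> * l)\<bar>"
      using norm_Pair_le[of "\<mu> * l" "(3 + tau) * (\<mu> * l)"] by simp
    also have "\<dots> = (4 + tau) * \<bar>\<mu>\<bar> * \<bar>l\<bar>"
      unfolding abs_mult abs_tau by (simp add: algebra_simps)
    \<comment> \<open>The product of the three bounds is about 0.583; the small factor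
      \<open>\<mu>\<close> is what brings it below 1.\<close>
    also have "\<dots> \<le> 424 / 100 * (16 / 100) * (86 / 100 * norm w)"
      using tau_bounds \<mu> l by (intro mult_mono) auto
    also have "\<dots> \<le> 6 / 10 * norm w" by simp
    finally show ?thesis .
  qed
  from linearly_stable_periodic_point[OF periodic_point_cycle_poly cont 4 this]
  show "attracting_periodic_point cycle_poly 4 (tau, 1)"
    "\<exists>U. open U \<and> (tau, 1) \<in> U \<and> U \<subseteq> E_S cycle_poly \<and>
     (\<forall>z\<in>U. (\<lambda>m. (?S ^^ (4 * m)) z) \<longlonglongrightarrow> (tau, 1))"
    by simp_all
qed

theorem theoremB:
  "(\<forall>p \<in> class_P. \<not> (\<exists>P. periodic_point p 2 P) \<and> \<not> (\<exists>P. periodic_point p 3 P)) \<and>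
   (\<exists>p \<in> class_P.
      (\<exists>P. attracting_periodic_point p 4 P) \<and>
      (\<exists>U. open U \<and> U \<noteq> {} \<and> U \<subseteq> E_S p \<and>
         (\<forall>z \<in> U. \<forall>\<alpha>. poly p \<alpha> = 0 \<longrightarrow>
            \<not> (\<lambda>m. (secant_map p ^^ m) z) \<longlonglongrightarrow> (\<alpha>, \<alpha>))))"
proof -
  obtain U where U: "open U" "(tau, 1) \<in> U" "U \<subseteq> E_S cycle_poly"
    "\<And>z. z \<in> U \<Longrightarrow> (\<lambda>m. (secant_map cycle_poly ^^ (4 * m)) z) \<longlonglongrightarrow> (tau, 1)"
    using cycle_poly_stability(2) by blast
  have "\<not> (\<lambda>m. (secant_map cycle_poly ^^ m) z) \<longlonglongrightarrow> (\<alpha>, \<alpha>)" if "z \<in> U" for z \<alpha>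
  proof
    assume "(\<lambda>m. (secant_map cycle_poly ^^ m) z) \<longlonglongrightarrow> (\<alpha>, \<alpha>)"
    \<comment> \<open>Every fourth iterate tends to \<open>(tau, 1)\<close>, which is off the
      diagonal, so the whole orbit cannot tend to a diagonal point.\<close>
    hence "((\<lambda>m. (secant_map cycle_poly ^^ m) z) \<circ> (\<lambda>m. 4 * m)) \<longlonglongrightarrow> (\<alpha>, \<alpha>)"
      by (rule LIMSEQ_subseq_LIMSEQ) (simp add: strict_mono_def)
    hence "(tau, 1) = (\<alpha>, \<alpha>)"
      using LIMSEQ_unique U(4)[OF that] by (auto simp: o_def)
    thus False using tau_bounds by auto
  qed
  thus ?thesis
    using no_periodic_point_2 no_periodic_point_3 cycle_poly_in_class_P cycle_poly_stability(1) U
    by blast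
qed

end
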